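(* Let $\lambda>0$, $\sigma_\eta>0$, let $N_{\mathsf y},N_{\mathsf z}\ge1$ be integers, and consider a planar rectangular array on the $YZ$-plane with $N=N_{\mathsf y}N_{\mathsf z}$ antennas at positions $\frac{\lambda}{2}[0,n_{\mathsf y},n_{\mathsf z}]^{\mathsf T}$, $n_{\mathsf y}=0,\dots,N_{\mathsf y}-1$, $n_{\mathsf z}=0,\dots,N_{\mathsf z}-1$, with reference location at the origin. Thus the antenna with indices $(n_{\mathsf y},n_{\mathsf z})$ (abbreviated by the single index $n$) has distance $d_{n0}=\frac{\lambda}{2}\tilde n$ with $\tilde n=\sqrt{n_{\mathsf y}^2+n_{\mathsf z}^2}$, azimuth $\phi_{n0}=\pi/2$ and elevation $\theta_{n0}=\arccos(n_{\mathsf z}/\tilde n)\in[0,\pi/2]$. Let the source lie on the $x$-axis at distance $d>0$ from the reference location, i.e. with spherical coordinates $(d,\theta,\phi)$ where $\theta=\pi/2$ and $\phi=0$. Let the measurement be $\mathbf{z}=h+\boldsymbol{\eta}\in\mathbb{R}^N$ with $\boldsymbol{\eta}\sim\mathcal{N}(\mathbf{0},\sigma_\eta^2\mathbf{I}_N)$, where $h$ is the differential-phase observation function (defined in the context), with the regularity convention on derivatives given in the context. For $\xi\in\{d,\theta,\phi\}$ let $\tilde J^{\mathrm D}(\xi)=\mathbb{E}_{\mathbf{z}\mid\xi}\left\{\left(\partial\ln p(\mathbf{z}\mid\xi)/\partial\xi\right)^2\right\}$ be the scalar Fisher information on $\xi$, evaluated at this source position. Then $$\tilde J^{\mathrm D}(d)=\frac{4\pi^2}{\lambda^2\sigma_\eta^2}\sum_{n_{\mathsf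 y}=0}^{N_{\mathsf y}-1}\sum_{n_{\mathsf z}=0}^{N_{\mathsf z}-1}\frac{8d^2+\lambda^2\tilde n^2-4d\sqrt{4d^2+\lambda^2\tilde n^2}}{4d^2+\lambda^2\tilde n^2},$$ $$\tilde J^{\mathrm D}(\theta)=\frac{4\pi^2}{\sigma_\eta^2}\sum_{n_{\mathsf y}=0}^{N_{\mathsf y}-1}\sum_{n_{\mathsf z}=0}^{N_{\mathsf z}-1}\frac{\tilde n^2d^2}{\tilde n^2\lambda^2+4d^2}\left(\cos\theta_{n0}\right)^2,$$ $$\tilde J^{\mathrm D}(\phi)=\frac{4\pi^2}{\sigma_\eta^2}\sum_{n_{\mathsf y}=0}^{N_{\mathsf y}-1}\sum_{n_{\mathsf z}=0}^{N_{\mathsf z}-1}\frac{\tilde n^2d^2}{\tilde n^2\lambda^2+4d^2}\left(\sin\theta_{n0}\right)^2.$$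
   Context: Geometry: a point has spherical coordinates $(\rho,\theta,\phi)$ relative to the reference location $\mathbf{r}$ (here the origin) if it equals $\mathbf{r}+\rho(\cos\phi\sin\theta,\sin\phi\sin\theta,\cos\theta)^{\mathsf T}$ ($\rho\ge0$ the distance, $\theta$ the elevation, $\phi$ the azimuth). For $n_{\mathsf y}=n_{\mathsf z}=0$ (so $\tilde n=0$, antenna at the reference location) $\theta_{n0}$ is given an arbitrary value; it only appears multiplied by $\tilde n=0$. The antennas are at $\mathbf{q}_n$ and the source at $\mathbf{p}$. Let $g_n=\sin\theta_{n0}\sin\theta\cos(\phi_{n0}-\phi)+\cos\theta_{n0}\cos\theta$; at the considered source position $g_n=0$ for all $n$. Observation model (as a function of general source coordinates $(d,\theta,\phi)$, with derivatives taken before setting $\theta=\pi/2,\phi=0$): $h$ is the vector of the $N$ entries $$h_n=\Delta\vartheta_n\bmod2\pi,\qquad\Delta\vartheta_n=\frac{2\pi}{\lambda}\Delta d_n,$$ $$\Delta d_n=\lVert\mathbf{p}-\mathbf{q}_n\rVert-\lVert\mathbf{p}-\mathbf{r}\rVert=d\left[\sqrt{1+\left(\frac{d_{n0}}{d}\right)^2-2\frac{d_{n0}}{d}g_n}-1\right].$$ The likelihood is $p(\mathbf{z}\mid\xi)=\mathcal{N}(\mathbf{z};h,\sigma_\eta^2\mathbf{I}_N)$, regarded as a function of the single parameter $\xi\in\{d,\theta,\phi\}$ with the other two coordinates fixed. Regularity convention: at the jump points of the modulo operation, the derivatives of $h_n$ are taken equal to the left and right derivatives; equivalently, in every derivative $h_n$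 is replaced by $\Delta\vartheta_n$. *)

theory Defs
  imports "HOL-Probability.Probability" "HOL-Library.Real_Mod"
begin

text \<open>Positions are points of $\mathbb{R}^3$; the reference location is the origin.\<close>

definition spherical :: "real \<Rightarrow> real \<Rightarrow> real \<Rightarrow> real ^ 3" where
  "spherical \<rho> \<theta> \<phi> =
     vector [\<rho> * (cos \<phi> * sin \<theta>), \<rho> * (sin \<phi> * sin \<theta>), \<rho> * cos \<theta>]"

definition antennas :: "nat \<Rightarrow> nat \<Rightarrow> (nat \<times> nat) set" where
  "antennas Ny Nz = {..<Ny} \<times> {..<Nz}"

fun antenna_pos :: "real \<Rightarrow> nat \<times> nat \<Rightarrow> real ^ 3" where
  "antenna_pos lam (ny, nz) = (lam / 2) *\<^sub>R vector [0, real ny, real nz]"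

fun ntilde :: "nat \<times> nat \<Rightarrow> real" where
  "ntilde (ny, nz) = sqrt ((real ny)\<^sup>2 + (real nz)\<^sup>2)"

type_synonym source_coords = "real \<times> real \<times> real"

fun source_pos :: "source_coords \<Rightarrow> real ^ 3" where
  "source_pos (d, \<theta>, \<phi>) = spherical d \<theta> \<phi>"

definition range_diff :: "real \<Rightarrow> source_coords \<Rightarrow> nat \<times> nat \<Rightarrow> real" where
  "range_diff lam s n =
     norm (source_pos s - antenna_pos lam n) - norm (source_pos s - 0)"

definition phase_diff :: "real \<Rightarrow> source_coords \<Rightarrow> nat \<times> nat \<Rightarrow> real" where
  "phase_diff lam s n = 2 * pi / lam * range_diff lam s n"

definition obs :: "real \<Rightarrow> source_coords \<Rightarrow> nat \<times> nat \<Rightarrow> real" where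
  "obs lam s n = phase_diff lam s n rmod (2 * pi)"

text \<open>
  The branch of the observation function through the point \<open>s0\<close>: it has the value of
  \<^term>\<open>obs\<close> at \<open>s0\<close> and the increments of \<^term>\<open>phase_diff\<close>.  Its derivatives at \<open>s0\<close> are
  those of \<^term>\<open>phase_diff\<close>, also at the jumps of the modulo operation; away from the
  jumps it coincides locally with \<^term>\<open>obs\<close> (\<open>eventually_obs_eq_branch\<close>).
\<close>

definition obs_branch ::
    "real \<Rightarrow> source_coords \<Rightarrow> source_coords \<Rightarrow> nat \<times> nat \<Rightarrow> real" where
  "obs_branch lam s0 s n = obs lam s0 n + (phase_diff lam s n - phase_diff lam s0 n)"

text \<open>
  Density of $\mathcal{N}(\mu, \sigma^2 \mathbf{I})$ on the coordinates indexed by \<open>A\<close>, with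
  respect to the product Lebesgue measure \<^term>\<open>\<Pi>\<^sub>M n\<in>A. lborel\<close>.
\<close>

definition gaussian_density :: "'i set \<Rightarrow> ('i \<Rightarrow> real) \<Rightarrow> real \<Rightarrow> ('i \<Rightarrow> real) \<Rightarrow> real" where
  "gaussian_density A \<mu> \<sigma> z =
     exp (- (\<Sum>n\<in>A. (z n - \<mu> n)\<^sup>2) / (2 * \<sigma>\<^sup>2)) / sqrt ((2 * pi * \<sigma>\<^sup>2) ^ card A)"

definition likelihood ::
    "nat \<Rightarrow> nat \<Rightarrow> real \<Rightarrow> real \<Rightarrow> source_coords \<Rightarrow> (nat \<times> nat \<Rightarrow> real) \<Rightarrow> real" where
  "likelihood Ny Nz lam \<sigma> s z = gaussian_density (antennas Ny Nz) (obs lam s) \<sigma> z"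

text \<open>
  The likelihood as it is to be differentiated at \<open>s0\<close>.  At \<open>s = s0\<close> it is the likelihood.
\<close>

definition likelihood_branch ::
    "nat \<Rightarrow> nat \<Rightarrow> real \<Rightarrow> real \<Rightarrow> source_coords \<Rightarrow> source_coords \<Rightarrow> (nat \<times> nat \<Rightarrow> real) \<Rightarrow> real"
  where
  "likelihood_branch Ny Nz lam \<sigma> s0 s z =
     gaussian_density (antennas Ny Nz) (obs_branch lam s0 s) \<sigma> z"

text \<open>
  Fisher information at \<open>\<xi>\<close> of the family of densities \<open>p\<close>, for a measurement \<open>Z\<close> on the
  probability space \<open>M\<close> whose law is the one belonging to the parameter value \<open>\<xi>\<close>.
\<close>

definition fisher_information ::
    "'w measure \<Rightarrow> ('w \<Rightarrow> 'z) \<Rightarrow> (real \<Rightarrow> 'z \<Rightarrow> real) \<Rightarrow> real \<Rightarrow> real" where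
  "fisher_information M Z p \<xi> = (LINT \<omega>|M. (deriv (\<lambda>x. ln (p x (Z \<omega>))) \<xi>)\<^sup>2)"

lemma likelihood_branch_self:
  "likelihood_branch Ny Nz lam \<sigma> s0 s0 z = likelihood Ny Nz lam \<sigma> s0 z"
proof -
  have "obs_branch lam s0 s0 = obs lam s0"
    by (simp add: obs_branch_def fun_eq_iff)
  thus ?thesis
    by (simp add: likelihood_branch_def likelihood_def)
qed

lemma eventually_obs_eq_branch:
  fixes c :: "real \<Rightarrow> source_coords"
  assumes cont: "isCont (\<lambda>x. phase_diff lam (c x) n) x0"
    and no_jump: "phase_diff lam (c x0) n / (2 * pi) \<notin> \<int>"
  shows "\<forall>\<^sub>F x in nhds x0. obs lam (c x) n = obs_branch lam (c x0) (c x) n"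
proof -
  let ?f = "\<lambda>x. phase_diff lam (c x) n / (2 * pi)"
  have "(?f \<longlongrightarrow> ?f x0) (nhds x0)"
    using cont by (intro tendsto_divide) (auto simp: isCont_def tendsto_nhds_iff)
  hence "\<forall>\<^sub>F x in nhds x0. \<lfloor>?f x\<rfloor> = \<lfloor>?f x0\<rfloor>"
    using no_jump by (rule eventually_floor_eq)
  thus ?thesis
    by eventually_elim (simp add: obs_branch_def obs_def rmod_def)
qed

lemma range_diff_closed_form:
  assumes d: "d > 0"
    and q: "antenna_pos lam n = spherical dn \<theta>n \<phi>n"
  shows "range_diff lam (d, \<theta>, \<phi>) n =
     d * (sqrt (1 + (dn / d)\<^sup>2
            - 2 * (dn / d) * (sin \<theta>n * sin \<theta> * cos (\<phi>n - \<phi>) + cos \<theta>n * cos \<theta>)) - 1)"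
proof -
  define g where "g = sin \<theta>n * sin \<theta> * cos (\<phi>n - \<phi>) + cos \<theta>n * cos \<theta>"
  have dot: "spherical a \<theta>1 \<phi>1 \<bullet> spherical b \<theta>2 \<phi>2
      = a * b * (sin \<theta>1 * sin \<theta>2 * cos (\<phi>1 - \<phi>2) + cos \<theta>1 * cos \<theta>2)" for a b \<theta>1 \<theta>2 \<phi>1 \<phi>2
    by (simp add: spherical_def inner_vec_def sum_3 cos_diff algebra_simps)
  have self: "spherical a \<theta>1 \<phi>1 \<bullet> spherical a \<theta>1 \<phi>1 = a\<^sup>2" for a \<theta>1 \<phi>1
    using sin_cos_squared_add[of \<theta>1] by (simp add: dot power2_eq_square[symmetric])
  have "norm (spherical d \<theta> \<phi>) = d"
    using d by (simp add: norm_eq_sqrt_inner self)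
  moreover have "norm (spherical d \<theta> \<phi> - spherical dn \<theta>n \<phi>n) = sqrt (d\<^sup>2 + dn\<^sup>2 - 2 * d * dn * g)"
    by (simp add: norm_eq_sqrt_inner inner_diff_left inner_diff_right self dot[of dn _ _ d]
        inner_commute[of "spherical d \<theta> \<phi>" "spherical dn \<theta>n \<phi>n"] g_def algebra_simps)
  moreover have "sqrt (d\<^sup>2 + dn\<^sup>2 - 2 * d * dn * g) = d * sqrt (1 + (dn / d)\<^sup>2 - 2 * (dn / d) * g)"
  proof -
    have "d\<^sup>2 + dn\<^sup>2 - 2 * d * dn * g = d\<^sup>2 * (1 + (dn / d)\<^sup>2 - 2 * (dn / d) * g)"
      using d by (simp add: field_simps power2_eq_square)
    thus ?thesis
      using d by (metis abs_of_pos real_sqrt_abs real_sqrt_mult)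
  qed
  ultimately show ?thesis
    unfolding range_diff_def source_pos.simps q g_def[symmetric] by (simp add: right_diff_distrib)
qed

lemma antenna_pos_spherical:
  assumes "n \<noteq> (0, 0)"
  shows "antenna_pos lam n =
     spherical (lam / 2 * ntilde n) (arccos (real (snd n) / ntilde n)) (pi / 2)"
proof (cases n)
  case (Pair ny nz)
  define t where "t = ntilde n"
  have t2: "t\<^sup>2 = (real ny)\<^sup>2 + (real nz)\<^sup>2"
    by (simp add: t_def Pair)
  have t: "t > 0"
    using assms by (simp add: t_def Pair sum_power2_gt_zero_iff)
  have "(real nz)\<^sup>2 \<le> t\<^sup>2"
    by (simp add: t2)
  hence "real nz \<le> t"
    using t by (rule power2_le_imp_le[OF _ less_imp_le])
  hence bnd: "-1 \<le> real nz / t" "real nz / t \<le> 1"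
    using t by (auto simp: field_simps)
  have "1 - (real nz / t)\<^sup>2 = (real ny / t)\<^sup>2"
  proof -
    have "(real ny)\<^sup>2 = t\<^sup>2 - (real nz)\<^sup>2"
      by (simp add: t2)
    thus ?thesis
      using t by (simp add: power_divide diff_divide_distrib)
  qed
  hence "sin (arccos (real nz / t)) = real ny / t"
    using bnd t by (simp add: sin_arccos real_sqrt_abs del: real_sqrt_power)
  moreover have "cos (arccos (real nz / t)) = real nz / t"
    using bnd by (simp add: cos_arccos)
  ultimately have "spherical (lam / 2 * t) (arccos (real nz / t)) (pi / 2) =
      vector [0, lam / 2 * real ny, lam / 2 * real nz]"
    using t by (simp add: spherical_def)
  thus ?thesis
    by (simp add: t_def[symmetric]) (simp add: Pair vec_eq_iff forall_3)
qed

end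

(*
  Along each coordinate the log-likelihood is differentiated at the true parameter, where the
  residual Z - h is the noise itself; so the score is a linear form in the noise, and since the
  noise coordinates are uncorrelated with variance sigma^2 the Fisher information is
  (sum of (dh_n/dxi)^2) / sigma^2.  The three derivatives are read off the Cartesian formula
  ||p - q_n||^2 = d^2 + (lam/2)^2 ntilde^2 - lam d (ny sin phi sin theta + nz cos theta).
*)
theory Submission
  imports Defs
begin

section \<open>Product form of the Gaussian density\<close>

text \<open>An isotropic covariance makes the coordinates independent. In this form the noise
  moments reduce to one-dimensional normal moments.\<close>

lemma gaussian_density_eq_prod:
  assumes "finite A" and "\<sigma> > 0"
  shows "gaussian_density A \<mu> \<sigma> z = (\<Prod>n\<in>A. normal_density (\<mu> n) \<sigma> (z n))"
proof -
  have "(\<Prod>n\<in>A. normal_density (\<mu> n) \<sigma> (z n))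
      = (1 / sqrt (2 * pi * \<sigma>\<^sup>2)) ^ card A * exp (\<Sum>n\<in>A. - (z n - \<mu> n)\<^sup>2 / (2 * \<sigma>\<^sup>2))"
    by (simp add: normal_density_def prod.distrib exp_sum assms(1) prod_dividef
        power_one_over)
  also have "(\<Sum>n\<in>A. - (z n - \<mu> n)\<^sup>2 / (2 * \<sigma>\<^sup>2)) = - (\<Sum>n\<in>A. (z n - \<mu> n)\<^sup>2) / (2 * \<sigma>\<^sup>2)"
    by (simp add: sum_divide_distrib sum_negf)
  finally show ?thesis
    by (simp add: gaussian_density_def power_divide power_one_over real_sqrt_power)
qed

section \<open>Geometry of the range differences\<close>

lemma norm_spherical: "norm (spherical \<rho> \<theta> \<phi>) = \<bar>\<rho>\<bar>"
proof -
  have "(\<rho> * (cos \<phi> * sin \<theta>))\<^sup>2 + (\<rho> * (sin \<phi> * sin \<theta>))\<^sup>2 + (\<rho> * cos \<theta>)\<^sup>2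
      = \<rho>\<^sup>2 * ((sin \<theta>)\<^sup>2 * ((sin \<phi>)\<^sup>2 + (cos \<phi>)\<^sup>2) + (cos \<theta>)\<^sup>2)"
    by (simp only: power_mult_distrib) (simp only: algebra_simps)
  also have "\<dots> = \<rho>\<^sup>2"
    by simp
  finally show ?thesis
    by (simp add: spherical_def norm_eq_sqrt_inner inner_vec_def sum_3 power2_eq_square[symmetric])
qed

text \<open>Expansion of the squared norm of p - q. Only antenna indices enter, so the antenna at
  the origin, whose elevation is arbitrary, needs no separate case. With
  \<open>\<bar>\<rho>\<bar>\<close> the identity holds for every real \<open>\<rho>\<close> and can
  be rewritten inside a derivative in the distance.\<close>

lemma range_diff_cartesian:
  "range_diff lam (\<rho>, \<theta>, \<phi>) (ny, nz) =
     sqrt (\<rho>\<^sup>2 + (lam / 2)\<^sup>2 * (ntilde (ny, nz))\<^sup>2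
       - lam * \<rho> * (real ny * sin \<phi> * sin \<theta> + real nz * cos \<theta>)) - \<bar>\<rho>\<bar>"
proof -
  let ?p = "spherical \<rho> \<theta> \<phi>" and ?q = "antenna_pos lam (ny, nz)"
  have "?p \<bullet> ?p = \<rho>\<^sup>2"
    by (simp add: norm_spherical dot_square_norm)
  moreover have "?q \<bullet> ?q = (lam / 2)\<^sup>2 * (ntilde (ny, nz))\<^sup>2"
    by (simp add: inner_vec_def sum_3 power2_eq_square algebra_simps)
  moreover have "2 * (?p \<bullet> ?q) = lam * \<rho> * (real ny * sin \<phi> * sin \<theta> + real nz * cos \<theta>)"
    by (simp add: spherical_def inner_vec_def sum_3 algebra_simps)
  ultimately show ?thesis
    by (simp add: range_diff_def norm_spherical norm_eq_sqrt_inner[of "?p - ?q"] inner_diff_left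
        inner_diff_right inner_commute[of ?q ?p] algebra_simps del: antenna_pos.simps ntilde.simps)
qed

section \<open>Noise covariance and Gaussian Fisher information\<close>

text \<open>Under a product density the expectation of a product of coordinate functions factorises.
  Integrability is recorded as well, since the Fisher information interchanges a finite sum with the
  integral.\<close>

lemma
  fixes M :: "'w measure" and \<eta> :: "'w \<Rightarrow> 'i \<Rightarrow> real"
  assumes A: "finite A" and \<sigma>: "\<sigma> > 0"
    and noise: "distributed M (\<Pi>\<^sub>M n\<in>A. lborel) \<eta> (\<lambda>x. ennreal (gaussian_density A (\<lambda>_. 0) \<sigma> x))"
    and mn: "m \<in> A" "n \<in> A"
  shows integrable_gaussian_noise_mult: "integrable M (\<lambda>\<omega>. \<eta> \<omega> m * \<eta> \<omega> n)"
    and integral_gaussian_noise_mult: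
      "(LINT \<omega>|M. \<eta> \<omega> m * \<eta> \<omega> n) = (if m = n then \<sigma>\<^sup>2 else 0)"
proof -
  interpret product_sigma_finite "\<lambda>_::'i. lborel :: real measure"
    by standard
  \<comment> \<open>The integrand factorises over the coordinates, with exponent 2 at \<open>m\<close> if \<open>m = n\<close>.\<close>
  define k :: "'i \<Rightarrow> nat" where "k i = of_bool (i = m) + of_bool (i = n)" for i
  define f where "f i x = normal_density 0 \<sigma> x * x ^ k i" for i x
  have meas: "(\<lambda>x. x m * x n) \<in> borel_measurable (\<Pi>\<^sub>M n\<in>A. (lborel :: real measure))"
    using mn by measurable
  have nonneg: "0 \<le> gaussian_density A (\<lambda>_. 0) \<sigma> x" for x
    using \<sigma> by (simp add: gaussian_density_def)
  have int_f: "integrable lborel (f i)" for i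
    using integrable_normal_moment[OF \<sigma>, of 0 "k i"] by (simp add: f_def[abs_def])
  have prod_f: "gaussian_density A (\<lambda>_. 0) \<sigma> x * (x m * x n) = (\<Prod>i\<in>A. f i (x i))" for x
  proof -
    have "(\<Prod>i\<in>A. x i ^ k i)
        = (\<Prod>i\<in>A. if i = m then x i else 1) * (\<Prod>i\<in>A. if i = n then x i else 1)"
      by (subst prod.distrib[symmetric]) (auto intro!: prod.cong simp: k_def power2_eq_square)
    also have "\<dots> = x m * x n"
      using A mn by simp
    finally show ?thesis
      by (simp add: f_def prod.distrib gaussian_density_eq_prod[OF A \<sigma>])
  qed
  show "integrable M (\<lambda>\<omega>. \<eta> \<omega> m * \<eta> \<omega> n)"
    using product_integrable_prod[OF A, of f] int_f
      distributed_integrable[OF noise meas nonneg] by (simp add: prod_f)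
  have "(LINT \<omega>|M. \<eta> \<omega> m * \<eta> \<omega> n) = (\<Prod>i\<in>A. integral\<^sup>L lborel (f i))"
    using product_integral_prod[OF A, of f] int_f
      distributed_integral[OF noise meas nonneg] by (simp add: prod_f)
  also have "\<dots> = (if m = n then \<sigma>\<^sup>2 else 0)"
  proof (cases "m = n")
    case True
    \<comment> \<open>The factor at \<open>m\<close> is the second central moment, the even moment
      with index 1; every other factor has exponent 0 and is the total mass.\<close>
    have "integral\<^sup>L lborel (f i) = (if i = m then \<sigma>\<^sup>2 else 1)" for i
      using integral_normal_moment_even[OF \<sigma>, of 0 1] \<sigma>
      by (simp add: f_def[abs_def] k_def True numeral_2_eq_2)
    thus ?thesis
      using A mn True by simp
  next
    case False
    \<comment> \<open>Here \<open>k m = 1\<close>, so this factor is the mean of a centred normal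
      variable, and its vanishing kills the whole product.\<close>
    have "integral\<^sup>L lborel (f m) = 0"
      using integral_normal_moment_odd[OF \<sigma>, of 0 0] False
      by (simp add: f_def[abs_def] k_def)
    thus ?thesis
      using A mn False by (auto intro!: prod_zero)
  qed
  finally show "(LINT \<omega>|M. \<eta> \<omega> m * \<eta> \<omega> n) = (if m = n then \<sigma>\<^sup>2 else 0)" .
qed

text \<open>The normalising constant does not depend on the mean, so only the quadratic form in the
  exponent contributes to the score.\<close>

lemma deriv_ln_gaussian_density:
  assumes \<sigma>: "\<sigma> > 0"
    and deriv: "\<And>n. n \<in> A \<Longrightarrow> ((\<lambda>x. \<mu> x n) has_real_derivative \<mu>' n) (at \<xi>)"
  shows "deriv (\<lambda>x. ln (gaussian_density A (\<mu> x) \<sigma> z)) \<xi>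
    = (\<Sum>n\<in>A. \<mu>' n * (z n - \<mu> \<xi> n)) / \<sigma>\<^sup>2"
proof (rule DERIV_imp_deriv)
  have "(\<lambda>x. ln (gaussian_density A (\<mu> x) \<sigma> z)) =
      (\<lambda>x. - (\<Sum>n\<in>A. (z n - \<mu> x n)\<^sup>2) / (2 * \<sigma>\<^sup>2) - ln (sqrt ((2 * pi * \<sigma>\<^sup>2) ^ card A)))"
    using \<sigma> by (simp add: gaussian_density_def ln_div)
  moreover have "((\<lambda>x. - (\<Sum>n\<in>A. (z n - \<mu> x n)\<^sup>2) / (2 * \<sigma>\<^sup>2) - ln (sqrt ((2 * pi * \<sigma>\<^sup>2) ^ card A)))
      has_real_derivative - (\<Sum>n\<in>A. 2 * (z n - \<mu> \<xi> n) * (- \<mu>' n)) / (2 * \<sigma>\<^sup>2)) (at \<xi>)"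
  proof -
    have "((\<lambda>x. (z n - \<mu> x n)\<^sup>2) has_real_derivative 2 * (z n - \<mu> \<xi> n) * (- \<mu>' n)) (at \<xi>)"
      if "n \<in> A" for n
      using deriv[OF that] by (auto intro!: derivative_eq_intros)
    from DERIV_diff[OF DERIV_cdivide[OF DERIV_minus[OF DERIV_sum[OF this]]] DERIV_const]
    show ?thesis
      by simp
  qed
  moreover have "- (\<Sum>n\<in>A. 2 * (z n - \<mu> \<xi> n) * (- \<mu>' n)) / (2 * \<sigma>\<^sup>2)
      = (\<Sum>n\<in>A. \<mu>' n * (z n - \<mu> \<xi> n)) / \<sigma>\<^sup>2"
  proof -
    have "- (\<Sum>n\<in>A. 2 * (z n - \<mu> \<xi> n) * (- \<mu>' n)) = 2 * (\<Sum>n\<in>A. \<mu>' n * (z n - \<mu> \<xi> n))"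
      by (simp add: sum_distrib_left sum_negf[symmetric] mult_ac)
    thus ?thesis
      by simp
  qed
  ultimately show "((\<lambda>x. ln (gaussian_density A (\<mu> x) \<sigma> z)) has_real_derivative
      (\<Sum>n\<in>A. \<mu>' n * (z n - \<mu> \<xi> n)) / \<sigma>\<^sup>2) (at \<xi>)"
    by simp
qed

text \<open>The mean may depend on the parameter in any way that is differentiable at
  \<open>\<xi>\<close>; the geometry enters only later, through \<open>\<mu>'\<close>.\<close>

lemma fisher_information_gaussian:
  fixes M :: "'w measure" and \<eta> :: "'w \<Rightarrow> 'i \<Rightarrow> real"
  assumes A: "finite A" and \<sigma>: "\<sigma> > 0"
    and noise: "distributed M (\<Pi>\<^sub>M n\<in>A. lborel) \<eta> (\<lambda>x. ennreal (gaussian_density A (\<lambda>_. 0) \<sigma> x))"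
    and Z: "\<And>\<omega> n. \<omega> \<in> space M \<Longrightarrow> n \<in> A \<Longrightarrow> Z \<omega> n = \<mu> \<xi> n + \<eta> \<omega> n"
    and deriv: "\<And>n. n \<in> A \<Longrightarrow> ((\<lambda>x. \<mu> x n) has_real_derivative \<mu>' n) (at \<xi>)"
  shows "fisher_information M Z (\<lambda>x. gaussian_density A (\<mu> x) \<sigma>) \<xi> = (\<Sum>n\<in>A. (\<mu>' n)\<^sup>2) / \<sigma>\<^sup>2"
proof -
  note integrable = integrable_gaussian_noise_mult[OF A \<sigma> noise]
  note integral = integral_gaussian_noise_mult[OF A \<sigma> noise]
  have "fisher_information M Z (\<lambda>x. gaussian_density A (\<mu> x) \<sigma>) \<xi>
      = (LINT \<omega>|M. ((\<Sum>n\<in>A. \<mu>' n * \<eta> \<omega> n) / \<sigma>\<^sup>2)\<^sup>2)"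
    unfolding fisher_information_def
    by (intro Bochner_Integration.integral_cong refl)
      (simp add: deriv_ln_gaussian_density[OF \<sigma> deriv] Z)
  \<comment> \<open>Squaring the linear form as a double sum exposes the products whose expectations
    are the noise covariances.\<close>
  also have "\<dots> = (LINT \<omega>|M. (\<Sum>m\<in>A. \<Sum>n\<in>A. \<mu>' m * \<mu>' n * (\<eta> \<omega> m * \<eta> \<omega> n)) / \<sigma> ^ 4)"
    by (simp add: power2_eq_square sum_product mult_ac power4_eq_xxxx)
  also have "\<dots> = (\<Sum>m\<in>A. \<Sum>n\<in>A. \<mu>' m * \<mu>' n * (if m = n then \<sigma>\<^sup>2 else 0)) / \<sigma> ^ 4"
    by (simp add: Bochner_Integration.integral_sum integrable integral)
  also have "\<dots> = (\<Sum>m\<in>A. (\<mu>' m)\<^sup>2 * \<sigma>\<^sup>2) / \<sigma> ^ 4"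
    using A by (simp add: if_distrib power2_eq_square cong: if_cong)
  also have "\<dots> = (\<Sum>n\<in>A. (\<mu>' n)\<^sup>2) / \<sigma>\<^sup>2"
    using \<sigma> by (simp add: sum_distrib_right[symmetric] power4_eq_xxxx power2_eq_square)
  finally show ?thesis .
qed

section \<open>Derivatives in the source coordinates\<close>

text \<open>At the source position p and q_n are orthogonal, so \<open>r\<close> is the distance
  from source to antenna. The mixed term vanishes there, but its angular derivatives do not.\<close>

lemma
  fixes d lam :: real and ny nz :: nat
  assumes d: "d > 0"
  defines "r \<equiv> sqrt (d\<^sup>2 + (lam / 2)\<^sup>2 * (ntilde (ny, nz))\<^sup>2)"
  shows has_derivative_range_diff_distance:
      "((\<lambda>d'. range_diff lam (d', pi / 2, 0) (ny, nz)) has_real_derivative d / r - 1) (at d)"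
    and has_derivative_range_diff_elevation:
      "((\<lambda>\<theta>. range_diff lam (d, \<theta>, 0) (ny, nz)) has_real_derivative
        lam * d * real nz / (2 * r)) (at (pi / 2))"
    and has_derivative_range_diff_azimuth:
      "((\<lambda>\<phi>. range_diff lam (d, pi / 2, \<phi>) (ny, nz)) has_real_derivative
        - (lam * d * real ny / (2 * r))) (at 0)"
proof -
  define K where "K = (lam / 2)\<^sup>2 * (ntilde (ny, nz))\<^sup>2"
  have pos: "d\<^sup>2 + K > 0"
    unfolding K_def using d by (intro add_pos_nonneg) auto
  \<comment> \<open>Shared by all three coordinates: \<open>f\<close> is the squared distance to the
    antenna, equal to \<open>d^2 + K\<close> at the source position, and \<open>g\<close> is the
    distance to the origin.\<close>
  have sqrt_diff: "((\<lambda>x. sqrt (f x) - g x) has_real_derivative D / (2 * r) - E) (at x)"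
    if "(f has_real_derivative D) (at x)" "f x = d\<^sup>2 + K" "(g has_real_derivative E) (at x)"
    for f g D E x
  proof -
    have r: "r = sqrt (f x)"
      by (simp only: r_def K_def that(2))
    have "f x > 0"
      using pos that(2) by simp
    from DERIV_diff[OF DERIV_chain2[OF DERIV_real_sqrt[OF this] that(1)] that(3)]
    show ?thesis
      unfolding r by (rule DERIV_cong) (simp add: inverse_eq_divide)
  qed
  \<comment> \<open>Since \<open>d > 0\<close>, the absolute value agrees with the identity on an
    open half-line around \<open>d\<close>.\<close>
  have abs: "(abs has_real_derivative 1) (at d)"
    by (rule has_field_derivative_transform_within_open[OF DERIV_ident open_greaterThan[of 0]])
      (use d in simp_all)
  have "((\<lambda>d'. d'\<^sup>2 + K - lam * d' * (real ny * sin 0 * sin (pi / 2) + real nz * cos (pi / 2)))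
      has_real_derivative 2 * d) (at d)"
    by (auto intro!: derivative_eq_intros)
  from sqrt_diff[OF this _ abs]
  show "((\<lambda>d'. range_diff lam (d', pi / 2, 0) (ny, nz)) has_real_derivative d / r - 1) (at d)"
    unfolding range_diff_cartesian K_def[symmetric] by simp
  have "((\<lambda>\<theta>. d\<^sup>2 + K - lam * d * (real ny * sin 0 * sin \<theta> + real nz * cos \<theta>))
      has_real_derivative lam * d * real nz) (at (pi / 2))"
    by (auto intro!: derivative_eq_intros)
  from sqrt_diff[OF this _ DERIV_const[of "\<bar>d\<bar>"]]
  show "((\<lambda>\<theta>. range_diff lam (d, \<theta>, 0) (ny, nz)) has_real_derivative
      lam * d * real nz / (2 * r)) (at (pi / 2))"
    unfolding range_diff_cartesian K_def[symmetric] by simp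
  have "((\<lambda>\<phi>. d\<^sup>2 + K - lam * d * (real ny * sin \<phi> * sin (pi / 2) + real nz * cos (pi / 2)))
      has_real_derivative - (lam * d * real ny)) (at 0)"
    by (auto intro!: derivative_eq_intros)
  from sqrt_diff[OF this _ DERIV_const[of "\<bar>d\<bar>"]]
  show "((\<lambda>\<phi>. range_diff lam (d, pi / 2, \<phi>) (ny, nz)) has_real_derivative
      - (lam * d * real ny / (2 * r))) (at 0)"
    unfolding range_diff_cartesian K_def[symmetric] by simp
qed

section \<open>Fisher information of the array\<close>

text \<open>The curve \<open>c\<close> varies one source coordinate through \<open>s0\<close>, so
  one statement serves distance, elevation and azimuth.\<close>

lemma fisher_information_likelihood_branch:
  fixes M :: "'w measure" and c :: "real \<Rightarrow> source_coords"
  assumes "\<sigma> > 0"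
    and noise: "distributed M (\<Pi>\<^sub>M n\<in>antennas Ny Nz. lborel) \<eta>
            (\<lambda>x. ennreal (gaussian_density (antennas Ny Nz) (\<lambda>_. 0) \<sigma> x))"
    and measurement: "\<And>\<omega>. \<omega> \<in> space M \<Longrightarrow>
            Z \<omega> = (\<lambda>n\<in>antennas Ny Nz. obs lam s0 n + \<eta> \<omega> n)"
    and c: "c \<xi> = s0"
    and deriv: "\<And>ny nz. ((\<lambda>x. range_diff lam (c x) (ny, nz)) has_real_derivative D ny nz) (at \<xi>)"
  shows "fisher_information M Z (\<lambda>x. likelihood_branch Ny Nz lam \<sigma> s0 (c x)) \<xi>
    = 4 * pi\<^sup>2 / (lam\<^sup>2 * \<sigma>\<^sup>2) * (\<Sum>ny<Ny. \<Sum>nz<Nz. (D ny nz)\<^sup>2)"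
proof -
  let ?A = "antennas Ny Nz" and ?\<mu>' = "\<lambda>(ny, nz). 2 * pi / lam * D ny nz"
  \<comment> \<open>The branch differs from \<open>phase_diff\<close> by a constant in
    \<open>x\<close>, so the modulo operation leaves no trace in the derivative.\<close>
  have "((\<lambda>x. obs_branch lam s0 (c x) n) has_real_derivative ?\<mu>' n) (at \<xi>)" for n
  proof (cases n)
    case (Pair ny nz)
    show ?thesis
      unfolding Pair obs_branch_def phase_diff_def prod.case
      by (rule DERIV_cong[OF DERIV_add[OF DERIV_const DERIV_diff[OF DERIV_cmult[OF deriv] DERIV_const]]])
        simp
  qed
  \<comment> \<open>At \<open>\<xi>\<close> the branch takes the value \<open>obs lam s0\<close>, so
    the measurement is its mean plus the noise.\<close>
  hence "fisher_information M Z (\<lambda>x. gaussian_density ?A (obs_branch lam s0 (c x)) \<sigma>) \<xi>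
      = (\<Sum>n\<in>?A. (?\<mu>' n)\<^sup>2) / \<sigma>\<^sup>2"
    using noise \<open>\<sigma> > 0\<close>
    by (intro fisher_information_gaussian)
      (auto simp: antennas_def measurement obs_branch_def c)
  also have "(\<Sum>n\<in>?A. (?\<mu>' n)\<^sup>2) = (2 * pi / lam)\<^sup>2 * (\<Sum>ny<Ny. \<Sum>nz<Nz. (D ny nz)\<^sup>2)"
    by (simp add: antennas_def sum.cartesian_product power_mult_distrib power_divide
        case_prod_unfold sum_distrib_left)
  finally show ?thesis
    by (simp add: likelihood_branch_def[abs_def] power_divide power_mult_distrib)
qed

theorem proposition5:
  fixes lam \<sigma> d :: real
    and Ny Nz :: nat
    and \<theta>0 :: "nat \<times> nat \<Rightarrow> real"
    and M :: "'w measure"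
    and \<eta> Z :: "'w \<Rightarrow> nat \<times> nat \<Rightarrow> real"
  assumes "lam > 0" and "\<sigma> > 0" and "d > 0" and "Ny \<ge> 1" and "Nz \<ge> 1"
    and elevation: "\<And>ny nz. (ny, nz) \<in> antennas Ny Nz \<Longrightarrow> (ny, nz) \<noteq> (0, 0) \<Longrightarrow>
            \<theta>0 (ny, nz) = arccos (real nz / ntilde (ny, nz))"
    and "prob_space M"
    and noise: "distributed M (\<Pi>\<^sub>M n\<in>antennas Ny Nz. lborel) \<eta>
            (\<lambda>x. ennreal (gaussian_density (antennas Ny Nz) (\<lambda>_. 0) \<sigma> x))"
    and measurement: "\<And>\<omega>. \<omega> \<in> space M \<Longrightarrow>
            Z \<omega> = (\<lambda>n\<in>antennas Ny Nz. obs lam (d, pi / 2, 0) n + \<eta> \<omega> n)"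
  shows
    "fisher_information M Z
       (\<lambda>d'. likelihood_branch Ny Nz lam \<sigma> (d, pi / 2, 0) (d', pi / 2, 0)) d
     = 4 * pi\<^sup>2 / (lam\<^sup>2 * \<sigma>\<^sup>2) *
       (\<Sum>ny<Ny. \<Sum>nz<Nz.
          (8 * d\<^sup>2 + lam\<^sup>2 * (ntilde (ny, nz))\<^sup>2
             - 4 * d * sqrt (4 * d\<^sup>2 + lam\<^sup>2 * (ntilde (ny, nz))\<^sup>2))
          / (4 * d\<^sup>2 + lam\<^sup>2 * (ntilde (ny, nz))\<^sup>2))
     \<and>
     fisher_information M Z
       (\<lambda>\<theta>. likelihood_branch Ny Nz lam \<sigma> (d, pi / 2, 0) (d, \<theta>, 0)) (pi / 2)
     = 4 * pi\<^sup>2 / \<sigma>\<^sup>2 *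
       (\<Sum>ny<Ny. \<Sum>nz<Nz.
          (ntilde (ny, nz))\<^sup>2 * d\<^sup>2 / ((ntilde (ny, nz))\<^sup>2 * lam\<^sup>2 + 4 * d\<^sup>2)
          * (cos (\<theta>0 (ny, nz)))\<^sup>2)
     \<and>
     fisher_information M Z
       (\<lambda>\<phi>. likelihood_branch Ny Nz lam \<sigma> (d, pi / 2, 0) (d, pi / 2, \<phi>)) 0
     = 4 * pi\<^sup>2 / \<sigma>\<^sup>2 *
       (\<Sum>ny<Ny. \<Sum>nz<Nz.
          (ntilde (ny, nz))\<^sup>2 * d\<^sup>2 / ((ntilde (ny, nz))\<^sup>2 * lam\<^sup>2 + 4 * d\<^sup>2)
          * (sin (\<theta>0 (ny, nz)))\<^sup>2)"
proof -
  note fisher = fisher_information_likelihood_branch[OF \<open>\<sigma> > 0\<close> noise measurement]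
  define t where "t n = ntilde n" for n
  define R where "R n = 4 * d\<^sup>2 + lam\<^sup>2 * (t n)\<^sup>2" for n
  have R: "R n > 0" for n
    unfolding R_def using \<open>d > 0\<close> by (intro add_pos_nonneg) auto
  \<comment> \<open>\<open>R\<close> is four times the squared source-antenna distance, which is the
    denominator in the claimed formulas.\<close>
  have r: "sqrt (d\<^sup>2 + (lam / 2)\<^sup>2 * (ntilde n)\<^sup>2) = sqrt (R n) / 2" for n
  proof -
    have "d\<^sup>2 + (lam / 2)\<^sup>2 * (ntilde n)\<^sup>2 = R n / 2\<^sup>2"
      by (simp add: R_def t_def power_divide add_divide_distrib del: ntilde.simps)
    thus ?thesis
      by (simp only: real_sqrt_divide) simp
  qed
  \<comment> \<open>Multiplied by \<open>ntilde\<close>, the cosine and sine of the elevation turn,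
    up to sign, into the antenna indices that appear in the derivatives. At the origin
    \<open>ntilde\<close> is 0, so any value of \<open>\<theta>0\<close> is admissible.\<close>
  have angle: "(ntilde (ny, nz) * cos (\<theta>0 (ny, nz)))\<^sup>2 = (real nz)\<^sup>2"
      "(ntilde (ny, nz) * sin (\<theta>0 (ny, nz)))\<^sup>2 = (real ny)\<^sup>2"
    if "ny < Ny" "nz < Nz" for ny nz
  proof -
    show cos: "(ntilde (ny, nz) * cos (\<theta>0 (ny, nz)))\<^sup>2 = (real nz)\<^sup>2"
    proof (cases "(ny, nz) = (0, 0)")
      case False
      \<comment> \<open>These bounds place the quotient in the domain of
        \<open>arccos\<close>.\<close>
      hence "ntilde (ny, nz) > 0" "real nz \<le> ntilde (ny, nz)"
        by (auto simp: sum_power2_gt_zero_iff intro: real_le_rsqrt)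
      moreover have "\<theta>0 (ny, nz) = arccos (real nz / ntilde (ny, nz))"
        using that False by (intro elevation) (auto simp: antennas_def)
      moreover from calculation have "cos (\<theta>0 (ny, nz)) = real nz / ntilde (ny, nz)"
        using cos_arccos[of "real nz / ntilde (ny, nz)"] by (simp add: field_simps del: ntilde.simps)
      ultimately show ?thesis
        by (simp del: ntilde.simps)
    qed simp
    show "(ntilde (ny, nz) * sin (\<theta>0 (ny, nz)))\<^sup>2 = (real ny)\<^sup>2"
      using cos by (simp add: power_mult_distrib sin_squared_eq algebra_simps)
  qed
  have distance: "(d / (sqrt (R n) / 2) - 1)\<^sup>2
      = (8 * d\<^sup>2 + lam\<^sup>2 * (t n)\<^sup>2 - 4 * d * sqrt (R n)) / R n" for n
  proof -
    have "(d / (sqrt (R n) / 2) - 1)\<^sup>2 = (2 * d - sqrt (R n))\<^sup>2 / (sqrt (R n))\<^sup>2"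
      using R[of n] by (subst power_divide[symmetric]) (simp add: diff_divide_distrib mult_ac)
    also have "\<dots> = (4 * d\<^sup>2 + R n - 4 * d * sqrt (R n)) / R n"
      using R[of n] by (simp add: power2_diff power_mult_distrib)
    finally show ?thesis
      by (simp add: R_def)
  qed
  \<comment> \<open>The factor \<open>lam^2\<close> split off here cancels the one in the
    denominator of the prefactor, so both angular formulas lose it.\<close>
  have lateral: "(lam * d * x / (2 * (sqrt (R n) / 2)))\<^sup>2 = lam\<^sup>2 * (x\<^sup>2 * d\<^sup>2 / R n)" for x n
    using R[of n] by (simp add: power_divide power_mult_distrib)
  have R_commute: "(ntilde n)\<^sup>2 * lam\<^sup>2 + 4 * d\<^sup>2 = R n" for n
    by (simp add: R_def t_def del: ntilde.simps)
  have "fisher_information M Z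
      (\<lambda>d'. likelihood_branch Ny Nz lam \<sigma> (d, pi / 2, 0) (d', pi / 2, 0)) d
    = 4 * pi\<^sup>2 / (lam\<^sup>2 * \<sigma>\<^sup>2) * (\<Sum>ny<Ny. \<Sum>nz<Nz. (d / (sqrt (R (ny, nz)) / 2) - 1)\<^sup>2)"
    using has_derivative_range_diff_distance[OF \<open>d > 0\<close>, of lam]
    by (intro fisher) (simp_all add: r del: ntilde.simps)
  moreover have "fisher_information M Z
      (\<lambda>\<theta>. likelihood_branch Ny Nz lam \<sigma> (d, pi / 2, 0) (d, \<theta>, 0)) (pi / 2)
    = 4 * pi\<^sup>2 / (lam\<^sup>2 * \<sigma>\<^sup>2) *
      (\<Sum>ny<Ny. \<Sum>nz<Nz. (lam * d * real nz / (2 * (sqrt (R (ny, nz)) / 2)))\<^sup>2)"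
    using has_derivative_range_diff_elevation[OF \<open>d > 0\<close>, of lam]
    by (intro fisher) (simp_all add: r del: ntilde.simps)
  moreover have "fisher_information M Z
      (\<lambda>\<phi>. likelihood_branch Ny Nz lam \<sigma> (d, pi / 2, 0) (d, pi / 2, \<phi>)) 0
    = 4 * pi\<^sup>2 / (lam\<^sup>2 * \<sigma>\<^sup>2) *
      (\<Sum>ny<Ny. \<Sum>nz<Nz. (- (lam * d * real ny / (2 * (sqrt (R (ny, nz)) / 2))))\<^sup>2)"
    using has_derivative_range_diff_azimuth[OF \<open>d > 0\<close>, of lam]
    by (intro fisher) (simp_all add: r del: ntilde.simps)
  moreover have "4 * pi\<^sup>2 / (lam\<^sup>2 * \<sigma>\<^sup>2) *
      (\<Sum>ny<Ny. \<Sum>nz<Nz. lam\<^sup>2 * ((real nz)\<^sup>2 * d\<^sup>2 / R (ny, nz)))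
    = 4 * pi\<^sup>2 / \<sigma>\<^sup>2 * (\<Sum>ny<Ny. \<Sum>nz<Nz.
        (ntilde (ny, nz))\<^sup>2 * d\<^sup>2 / R (ny, nz) * (cos (\<theta>0 (ny, nz)))\<^sup>2)"
  proof -
    have "(\<Sum>ny<Ny. \<Sum>nz<Nz. lam\<^sup>2 * ((real nz)\<^sup>2 * d\<^sup>2 / R (ny, nz)))
      = lam\<^sup>2 * (\<Sum>ny<Ny. \<Sum>nz<Nz.
          (ntilde (ny, nz))\<^sup>2 * d\<^sup>2 / R (ny, nz) * (cos (\<theta>0 (ny, nz)))\<^sup>2)"
      unfolding sum_distrib_left
      by (intro sum.cong refl) (simp add: angle(1)[symmetric] power_mult_distrib del: ntilde.simps)
    thus ?thesis
      using \<open>lam > 0\<close> by (simp del: ntilde.simps)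
  qed
  moreover have "4 * pi\<^sup>2 / (lam\<^sup>2 * \<sigma>\<^sup>2) *
      (\<Sum>ny<Ny. \<Sum>nz<Nz. lam\<^sup>2 * ((real ny)\<^sup>2 * d\<^sup>2 / R (ny, nz)))
    = 4 * pi\<^sup>2 / \<sigma>\<^sup>2 * (\<Sum>ny<Ny. \<Sum>nz<Nz.
        (ntilde (ny, nz))\<^sup>2 * d\<^sup>2 / R (ny, nz) * (sin (\<theta>0 (ny, nz)))\<^sup>2)"
  proof -
    have "(\<Sum>ny<Ny. \<Sum>nz<Nz. lam\<^sup>2 * ((real ny)\<^sup>2 * d\<^sup>2 / R (ny, nz)))
      = lam\<^sup>2 * (\<Sum>ny<Ny. \<Sum>nz<Nz.
          (ntilde (ny, nz))\<^sup>2 * d\<^sup>2 / R (ny, nz) * (sin (\<theta>0 (ny, nz)))\<^sup>2)"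
      unfolding sum_distrib_left
      by (intro sum.cong refl) (simp add: angle(2)[symmetric] power_mult_distrib del: ntilde.simps)
    thus ?thesis
      using \<open>lam > 0\<close> by (simp del: ntilde.simps)
  qed
  \<comment> \<open>\<open>power2_minus\<close> discards the negative sign of the azimuth
    derivative.\<close>
  ultimately show ?thesis
    unfolding R_commute power2_minus lateral distance
    by (simp only: R_def t_def)
qed

end
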